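(* For any fixed graph $F$ of type I and any integer $r\ge 3$, we have $sat_r(n,F)=O(n)$ as $n\to\infty$, where the implied constant may depend on $F$ and $r$.
   Context: Let $F$ be a finite simple graph on $v$ vertices with degree sequence $d_1\le d_2\le\dots\le d_v$. $F$ is of type I if there exist two adjacent vertices $u_1,u_2$ of $F$ with $d_F(u_1)=d_1$ and $d_F(u_2)=d_2$. A hypergraph $H$ is a Berge copy of a graph $F$ (a Berge-$F$) if $V(F)\subset V(H)$ and there is a bijection $f:E(F)\to E(H)$ such that $e\subset f(e)$ for every $e\in E(F)$ (with $F$ identified with a copy of it on vertices of $H$). A hypergraph is Berge-$F$-free if it contains no Berge-$F$ as a subhypergraph. An $r$-uniform hypergraph $H$ is Berge-$F$-saturated if it is Berge-$F$-free, but adding to $H$ any $r$-subset of $V(H)$ that is not already a hyperedge creates a Berge-$F$. $sat_r(n,F)$ denotes the minimum number of hyperedges in a Berge-$F$-saturated $r$-uniform hypergraph on $n$ vertices. *)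

theory Defs
  imports Complex_Main "HOL-Library.Multiset" "HOL-Library.Landau_Symbols"
begin

text \<open>A (finite) hypergraph is given by its vertex set and its set of hyperedges, so there
  are no repeated hyperedges. A finite simple graph is a 2-uniform hypergraph.\<close>

definition hypergraph :: "'a set \<Rightarrow> 'a set set \<Rightarrow> bool" where
  "hypergraph V E \<longleftrightarrow> finite V \<and> (\<forall>e\<in>E. e \<subseteq> V)"

definition uniform_hypergraph :: "nat \<Rightarrow> 'a set \<Rightarrow> 'a set set \<Rightarrow> bool" where
  "uniform_hypergraph r V E \<longleftrightarrow> hypergraph V E \<and> (\<forall>e\<in>E. card e = r)"

abbreviation simple_graph :: "'a set \<Rightarrow> 'a set set \<Rightarrow> bool" where
  "simple_graph \<equiv> uniform_hypergraph 2"

definition subhypergraph :: "'a set \<Rightarrow> 'a set set \<Rightarrow> 'a set \<Rightarrow> 'a set set \<Rightarrow> bool" where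
  "subhypergraph V' E' V E \<longleftrightarrow> hypergraph V' E' \<and> V' \<subseteq> V \<and> E' \<subseteq> E"

definition degree :: "'a set set \<Rightarrow> 'a \<Rightarrow> nat" where
  "degree E u = card {e \<in> E. u \<in> e}"

definition degree_sequence :: "'a set \<Rightarrow> 'a set set \<Rightarrow> nat list" where
  "degree_sequence V E = sorted_list_of_multiset (image_mset (degree E) (mset_set V))"

text \<open>List positions 0 and 1 hold \<open>d\<^sub>1\<close> and \<open>d\<^sub>2\<close>. Both exist, since adjacent
  vertices of a simple graph are distinct.\<close>

definition type_I :: "'a set \<Rightarrow> 'a set set \<Rightarrow> bool" where
  "type_I V E \<longleftrightarrow> (\<exists>u1\<in>V. \<exists>u2\<in>V. {u1, u2} \<in> E \<and>
     degree E u1 = degree_sequence V E ! 0 \<and> degree E u2 = degree_sequence V E ! 1)"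

text \<open>The injection \<open>\<phi>\<close> identifies the graph \<open>(VF, EF)\<close> with a copy of it on vertices of
  the hypergraph \<open>(V, E)\<close>.\<close>

definition is_Berge :: "'a set \<Rightarrow> 'a set set \<Rightarrow> 'b set \<Rightarrow> 'b set set \<Rightarrow> bool" where
  "is_Berge VF EF V E \<longleftrightarrow> (\<exists>\<phi> f. inj_on \<phi> VF \<and> \<phi> ` VF \<subseteq> V \<and>
     bij_betw f EF E \<and> (\<forall>e\<in>EF. \<phi> ` e \<subseteq> f e))"

definition contains_Berge :: "'a set \<Rightarrow> 'a set set \<Rightarrow> 'b set \<Rightarrow> 'b set set \<Rightarrow> bool" where
  "contains_Berge VF EF V E \<longleftrightarrow>
     (\<exists>V' E'. subhypergraph V' E' V E \<and> is_Berge VF EF V' E')"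

definition Berge_saturated :: "nat \<Rightarrow> 'a set \<Rightarrow> 'a set set \<Rightarrow> 'b set \<Rightarrow> 'b set set \<Rightarrow> bool" where
  "Berge_saturated r VF EF V E \<longleftrightarrow> uniform_hypergraph r V E \<and>
     \<not> contains_Berge VF EF V E \<and>
     (\<forall>e. e \<subseteq> V \<and> card e = r \<and> e \<notin> E \<longrightarrow> contains_Berge VF EF V (insert e E))"

text \<open>Hypergraphs on \<open>n\<close> vertices are taken, up to isomorphism, on sets of natural numbers.
  The infimum is a minimum whenever the graph has an edge, as is the case for graphs
  of type I; see \<open>sat_attained\<close> below.\<close>

definition sat :: "nat \<Rightarrow> nat \<Rightarrow> 'a set \<Rightarrow> 'a set set \<Rightarrow> nat" where
  "sat r n VF EF =
     Inf {card E |(V :: nat set) E. finite V \<and> card V = n \<and> Berge_saturated r VF EF V E}"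

lemma Berge_saturated_exists:
  assumes "EF \<noteq> {}" "finite V"
  shows "\<exists>E. Berge_saturated r VF EF V E"
proof -
  let ?S = "{E. uniform_hypergraph r V E \<and> \<not> contains_Berge VF EF V E}"
  have "?S \<subseteq> Pow (Pow V)"
    by (auto simp: uniform_hypergraph_def hypergraph_def)
  then have fin: "finite ?S"
    using assms(2) finite_subset by blast
  have "{} \<in> ?S"
    using assms by (simp add: uniform_hypergraph_def hypergraph_def contains_Berge_def
        subhypergraph_def is_Berge_def bij_betw_def)
  then obtain E where E: "E \<in> ?S" and max: "\<And>E'. E' \<in> ?S \<Longrightarrow> E \<subseteq> E' \<Longrightarrow> E = E'"
    using finite_has_maximal[OF fin] by blast
  have "contains_Berge VF EF V (insert e E)" if e: "e \<subseteq> V" "card e = r" "e \<notin> E" for e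
  proof (rule ccontr)
    assume "\<not> contains_Berge VF EF V (insert e E)"
    with E e have "insert e E \<in> ?S"
      by (auto simp: uniform_hypergraph_def hypergraph_def)
    from max[OF this] e(3) show False by blast
  qed
  with E show ?thesis
    by (auto simp: Berge_saturated_def)
qed

lemma sat_attained:
  assumes "EF \<noteq> {}"
  shows "\<exists>(V :: nat set) E. finite V \<and> card V = n \<and> Berge_saturated r VF EF V E \<and>
           card E = sat r n VF EF"
proof -
  let ?K = "{card E |(V :: nat set) E. finite V \<and> card V = n \<and> Berge_saturated r VF EF V E}"
  obtain E where "Berge_saturated r VF EF {..<n} E"
    using Berge_saturated_exists[OF assms, of "{..<n}"] by blast
  moreover have "finite {..<n}" "card {..<n} = n" by simp_all
  ultimately have "card E \<in> ?K" by blast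
  then have "?K \<noteq> {}" by blast
  then have "sat r n VF EF \<in> ?K"
    unfolding sat_def by (rule Inf_nat_def1)
  then obtain V :: "nat set" and E where "sat r n VF EF = card E" "finite V" "card V = n"
    "Berge_saturated r VF EF V E"
    by blast
  then show ?thesis
    by metis
qed

end

theory Submission
  imports Defs
begin

text \<open>Write \<open>u\<^sub>1 u\<^sub>2\<close> for the edge given by type I. If all vertices outside a core of \<open>v - 2\<close>
  vertices have degree at most \<open>d\<^sub>2 - 1\<close>, there is no Berge copy of \<open>F\<close>: it would use two
  outside vertices, and at most one vertex of \<open>F\<close> has degree below \<open>d\<^sub>2\<close>. Identify the core with
  \<open>F - u\<^sub>1 - u\<^sub>2\<close>, realise the edges there by hyperedges with private padding, and let all but
  boundedly many outside vertices lie in exactly \<open>d\<^sub>2 - 1\<close> hyperedges, so linked to the core that each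
  of them can play the role of \<open>u\<^sub>1\<close> as well as that of \<open>u\<^sub>2\<close>. This is possible because a
  hyperedge has room for two core vertices and an outside vertex when \<open>r \<ge> 3\<close>. These outside vertices
  split into blocks of bounded size, and a new hyperedge meeting two blocks supplies the missing edge
  \<open>u\<^sub>1 u\<^sub>2\<close>. Hence every saturated extension has \<open>O(1)\<close> hyperedges per block.\<close>

section \<open>Berge copies and saturated extensions\<close>

text \<open>Taking all of \<open>V\<close> with just the hyperedges used by \<open>f\<close> as the
  subhypergraph reduces a Berge copy to two injections.\<close>

lemma contains_Berge_iff:
  assumes "hypergraph V E"
  shows "contains_Berge VF EF V E \<longleftrightarrow> (\<exists>\<phi> f. inj_on \<phi> VF \<and> \<phi> ` VF \<subseteq> V \<and>
     inj_on f EF \<and> f ` EF \<subseteq> E \<and> (\<forall>a\<in>EF. \<phi> ` a \<subseteq> f a))" (is "_ \<longleftrightarrow> ?R")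
proof
  assume "contains_Berge VF EF V E"
  then obtain V' E' where "V' \<subseteq> V" "E' \<subseteq> E" "is_Berge VF EF V' E'"
    unfolding contains_Berge_def subhypergraph_def by blast
  then obtain \<phi> f where *: "V' \<subseteq> V" "E' \<subseteq> E" "inj_on \<phi> VF" "\<phi> ` VF \<subseteq> V'"
     "bij_betw f EF E'" "\<forall>e\<in>EF. \<phi> ` e \<subseteq> f e"
    unfolding is_Berge_def by metis
  then have "inj_on f EF" "f ` EF \<subseteq> E" "\<phi> ` VF \<subseteq> V" by (auto simp: bij_betw_def)
  with * show ?R by blast
next
  assume ?R
  then obtain \<phi> f where *: "inj_on \<phi> VF" "\<phi> ` VF \<subseteq> V"
     "inj_on f EF" "f ` EF \<subseteq> E" "\<forall>a\<in>EF. \<phi> ` a \<subseteq> f a" by metis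
  have "subhypergraph V (f ` EF) V E"
    using assms *(4) unfolding subhypergraph_def hypergraph_def by (meson order_refl subsetD)
  moreover have "is_Berge VF EF V (f ` EF)"
    unfolding is_Berge_def using *
    by (intro exI[of _ \<phi>] exI[of _ f]) (simp add: inj_on_imp_bij_betw)
  ultimately show "contains_Berge VF EF V E"
    unfolding contains_Berge_def by blast
qed

lemma contains_Berge_mono:
  assumes "contains_Berge VF EF V E" "E \<subseteq> E'"
  shows "contains_Berge VF EF V E'"
  using assms unfolding contains_Berge_def subhypergraph_def by blast

text \<open>A maximal Berge-free uniform superset of \<open>E0\<close> is saturated, so the
  construction itself need only be Berge-free.\<close>

lemma Berge_saturated_extension:
  assumes "uniform_hypergraph r V E0" "\<not> contains_Berge VF EF V E0"
  obtains E where "E0 \<subseteq> E" "Berge_saturated r VF EF V E"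
proof -
  let ?S = "{E. uniform_hypergraph r V E \<and> \<not> contains_Berge VF EF V E}"
  have finV: "finite V"
    using assms(1) by (simp add: uniform_hypergraph_def hypergraph_def)
  have "?S \<subseteq> Pow (Pow V)"
    by (auto simp: uniform_hypergraph_def hypergraph_def)
  then have fin: "finite ?S"
    using finV finite_subset by blast
  have "E0 \<in> ?S" using assms by simp
  from finite_has_maximal2[OF fin this] obtain E
    where E: "E \<in> ?S" "E0 \<subseteq> E" and max: "\<And>E'. E' \<in> ?S \<Longrightarrow> E \<subseteq> E' \<Longrightarrow> E = E'"
    by metis
  have "contains_Berge VF EF V (insert e E)" if e: "e \<subseteq> V" "card e = r" "e \<notin> E" for e
  proof (rule ccontr)
    assume "\<not> contains_Berge VF EF V (insert e E)"
    with E e have "insert e E \<in> ?S"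
      by (auto simp: uniform_hypergraph_def hypergraph_def)
    from max[OF this] e(3) show False by blast
  qed
  with E have "Berge_saturated r VF EF V E"
    by (auto simp: Berge_saturated_def)
  with E(2) show thesis by (rule that)
qed

section \<open>Degrees, neighbourhoods and the second smallest degree\<close>

lemma degree_le_degree_of_Berge:
  assumes "finite E" "inj_on f EF" "f ` EF \<subseteq> E" "\<forall>a\<in>EF. \<phi> ` a \<subseteq> f a"
  shows "degree EF u \<le> degree E (\<phi> u)"
  unfolding degree_def
proof (rule card_inj_on_le[where f = f])
  show "inj_on f {e \<in> EF. u \<in> e}" using assms(2) by (rule inj_on_subset) auto
  show "f ` {e \<in> EF. u \<in> e} \<subseteq> {e \<in> E. \<phi> u \<in> e}" using assms(3,4) by blast
qed (use assms(1) in auto)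

definition neighbours :: "'a set set \<Rightarrow> 'a \<Rightarrow> 'a set" where
  "neighbours E u = {w. {u, w} \<in> E}"

lemma card_neighbours:
  assumes "simple_graph V E"
  shows "card (neighbours E u) = degree E u"
proof -
  have "bij_betw (\<lambda>w. {u, w}) (neighbours E u) {e \<in> E. u \<in> e}"
    unfolding bij_betw_def
  proof (intro conjI set_eqI iffI)
    show "inj_on (\<lambda>w. {u, w}) (neighbours E u)"
      by (auto simp: inj_on_def doubleton_eq_iff)
    fix e assume e: "e \<in> {e \<in> E. u \<in> e}"
    then have "card e = 2"
      using assms by (auto simp: uniform_hypergraph_def)
    with e obtain w where "e = {u, w}"
      by (auto simp: card_2_iff insert_commute)
    with e show "e \<in> (\<lambda>w. {u, w}) ` neighbours E u"
      by (auto simp: neighbours_def)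
  qed (auto simp: neighbours_def)
  then show ?thesis
    by (simp add: degree_def bij_betw_same_card)
qed

lemma card_neighbours_remove:
  assumes "simple_graph V E" "{u, w} \<in> E"
  shows "card (neighbours E u - {w}) = degree E u - 1"
proof -
  have "w \<in> neighbours E u" using assms(2) by (simp add: neighbours_def)
  then show ?thesis
    by (simp add: card_Diff_singleton card_neighbours[OF assms(1)])
qed

text \<open>In a sorted list only position 0 can hold a value strictly below the entry at position
  1, so two distinct vertices cannot both have smaller degree.\<close>

lemma degree_sequence_second:
  assumes "finite V" "u \<in> V" "w \<in> V" "u \<noteq> w"
  shows "degree_sequence V E ! 0 \<le> degree_sequence V E ! 1"
    and "degree_sequence V E ! 1 \<le> degree E u \<or> degree_sequence V E ! 1 \<le> degree E w"
proof -
  let ?xs = "degree_sequence V E"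
  have mset: "mset ?xs = image_mset (degree E) (mset_set V)" and sorted: "sorted ?xs"
    by (simp_all add: degree_sequence_def)
  have "card {u, w} \<le> card V"
    using assms by (intro card_mono) auto
  then have "2 \<le> length ?xs"
    using assms(4) mset by (metis card_2_iff size_image_mset size_mset size_mset_set)
  then obtain a b ys where xs: "?xs = a # b # ys"
    by (metis Suc_le_length_iff numeral_2_eq_2)
  with sorted show "?xs ! 0 \<le> ?xs ! 1" by simp
  show "?xs ! 1 \<le> degree E u \<or> ?xs ! 1 \<le> degree E w"
  proof (rule ccontr)
    assume neg: "\<not> ?thesis"
    have "filter (\<lambda>d. d < b) ys = []"
      using sorted xs by (auto simp: filter_empty_conv)
    then have "length (filter (\<lambda>d. d < b) ?xs) \<le> 1"
      using xs by simp
    moreover have "length (filter (\<lambda>d. d < b) ?xs) = size (filter_mset (\<lambda>d. d < b) (mset ?xs))"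
      by (metis mset_filter size_mset)
    moreover have "\<dots> = card {z \<in> V. degree E z < b}"
      by (simp add: mset filter_mset_image_mset assms(1) filter_mset_mset_set)
    moreover have "card {u, w} \<le> card {z \<in> V. degree E z < b}"
      using assms neg xs by (intro card_mono) auto
    ultimately show False using assms(4) by simp
  qed
qed

text \<open>Fix the intersection and inject \<open>A - B\<close> into \<open>B - A\<close>, which is
  large enough because both differences drop the same intersection.\<close>

lemma extend_identity_inj:
  assumes "finite A" "finite B" "card A \<le> card B"
  obtains g where "inj_on g A" "g ` A \<subseteq> B" "\<And>w. w \<in> A \<Longrightarrow> w \<in> B \<Longrightarrow> g w = w"
proof -
  have "card A = card (A - B) + card (A \<inter> B)" "card B = card (B - A) + card (A \<inter> B)"
    using assms card_Diff_subset_Int[of A B] card_Diff_subset_Int[of B A]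
      card_mono[of A "A \<inter> B"] card_mono[of B "A \<inter> B"]
    by (auto simp: Int_commute)
  then have "card (A - B) \<le> card (B - A)" using assms(3) by linarith
  then obtain f where f: "f ` (A - B) \<subseteq> B - A" "inj_on f (A - B)"
    using assms(1,2) card_le_inj[of "A - B" "B - A"] by auto
  define g where "g = (\<lambda>w. if w \<in> B then w else f w)"
  have f_in: "f x \<in> B" "f x \<notin> A" if "x \<in> A" "x \<notin> B" for x using f(1) that by auto
  have "inj_on g A"
  proof (rule inj_onI)
    fix a b assume "a \<in> A" "b \<in> A" "g a = g b"
    then show "a = b"
      using f_in[of a] f_in[of b] inj_onD[OF f(2), of a b] unfolding g_def by (auto split: if_splits)
  qed
  moreover have "g ` A \<subseteq> B" using f unfolding g_def by auto
  moreover have "g w = w" if "w \<in> A" "w \<in> B" for w using that by (simp add: g_def)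
  ultimately show thesis using that by blast
qed

lemma div_class_eq: "0 < s \<Longrightarrow> {y :: nat. y div s = t} = {t * s..<t * s + s}"
  by (auto simp: div_nat_eqI dividend_less_times_div mult.commute)
     (metis add.commute dividend_less_div_times mult.commute)+

text \<open>The vertices below \<open>M\<close> are those linked to the core, the block of \<open>x\<close> being given by
  \<open>x div ((r - 1) * (r - 2))\<close>. The core is the range of \<open>\<psi>\<close>, and \<open>S a\<close> pads the edge \<open>a\<close> of
  \<open>F - u\<^sub>1 - u\<^sub>2\<close> to a hyperedge.\<close>

locale type_I_construction =
  fixes VF :: "'a set" and EF :: "'a set set" and u1 u2 :: 'a and g :: "'a \<Rightarrow> 'a"
    and r n M :: nat and \<psi> :: "'a \<Rightarrow> nat" and S :: "'a set \<Rightarrow> nat set"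
  assumes simple: "simple_graph VF EF"
    and edge: "{u1, u2} \<in> EF"
    and lower_degree: "\<And>u w. u \<in> VF \<Longrightarrow> w \<in> VF \<Longrightarrow> u \<noteq> w \<Longrightarrow>
          degree EF u2 \<le> degree EF u \<or> degree EF u2 \<le> degree EF w"
    and r: "3 \<le> r"
    and M: "(r - 1) * (r - 2) dvd M" "M \<le> n"
    and g: "inj_on g (neighbours EF u1 - {u2})"
           "g ` (neighbours EF u1 - {u2}) \<subseteq> neighbours EF u2 - {u1}"
           "\<And>w. w \<in> neighbours EF u1 - {u2} \<Longrightarrow> w \<in> neighbours EF u2 - {u1} \<Longrightarrow> g w = w"
    and \<psi>: "inj_on \<psi> (VF - {u1, u2})" "\<psi> ` (VF - {u1, u2}) \<subseteq> {M..<n}"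
    and S: "\<And>a. a \<in> EF \<Longrightarrow> S a \<subseteq> {M..<n} - \<psi> ` (VF - {u1, u2})"
           "\<And>a. a \<in> EF \<Longrightarrow> card (S a) = r - 2"
           "\<And>a b. a \<in> EF \<Longrightarrow> b \<in> EF \<Longrightarrow> a \<noteq> b \<Longrightarrow> S a \<inter> S b = {}"
begin

abbreviation "R \<equiv> VF - {u1, u2}"
abbreviation "N1 \<equiv> neighbours EF u1 - {u2}"
abbreviation "N2 \<equiv> neighbours EF u2 - {u1}"
abbreviation "ER \<equiv> {a \<in> EF. u1 \<notin> a \<and> u2 \<notin> a}"

text \<open>A hyperedge containing the images of \<open>w\<close> and of its preimage under \<open>g\<close> serves as the edge
  \<open>u\<^sub>2 w\<close> or as the edge \<open>u\<^sub>1 (g\<^sup>-\<^sup>1 w)\<close>. Since \<open>g\<close> fixes common neighbours, distinct \<open>w\<close> have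
  distinct groups. Groups have one or two elements, which explains the block size.\<close>

definition core_group :: "'a \<Rightarrow> 'a set" where
  "core_group w = insert w {w' \<in> N1. g w' = w}"

definition part_size :: "'a \<Rightarrow> nat" where
  "part_size w = r - card (core_group w)"

text \<open>For fixed \<open>w\<close>, the classes of \<open>part_size w\<close> consecutive
  numbers tile the vertices below \<open>M\<close>, so each of these lies in exactly one link
  hyperedge per \<open>w\<close>.\<close>

definition link_edge :: "'a \<Rightarrow> nat \<Rightarrow> nat set" where
  "link_edge w x = \<psi> ` core_group w \<union> {y. y div part_size w = x div part_size w}"

definition core_edge :: "'a set \<Rightarrow> nat set" where
  "core_edge a = \<psi> ` a \<union> S a"

definition base_edges :: "nat set set" where
  "base_edges = (\<Union>w\<in>N2. link_edge w ` {..<M}) \<union> core_edge ` ER"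

section \<open>Shape of the base hyperedges\<close>

lemma finite_VF: "finite VF"
  and edge_subset: "a \<in> EF \<Longrightarrow> a \<subseteq> VF"
  and card_edge: "a \<in> EF \<Longrightarrow> card a = 2"
  using simple by (auto simp: uniform_hypergraph_def hypergraph_def)

lemma finite_EF: "finite EF"
  by (meson Pow_iff edge_subset finite_Pow_iff finite_VF finite_subset subsetI)

lemma u12: "u1 \<noteq> u2" "u1 \<in> VF" "u2 \<in> VF"
  using card_edge[OF edge] edge_subset[OF edge] by auto

lemma N1_subset: "N1 \<subseteq> R" and N2_subset: "N2 \<subseteq> R"
  using edge_subset card_edge by (fastforce simp: neighbours_def)+

lemma finite_N1: "finite N1" and finite_N2: "finite N2"
  using N1_subset N2_subset finite_VF by (meson finite_Diff finite_subset)+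

lemma card_N2: "card N2 = degree EF u2 - 1"
  using card_neighbours_remove[OF simple, of u2 u1] edge by (simp add: insert_commute)

lemma group_subset: "w \<in> N2 \<Longrightarrow> core_group w \<subseteq> R"
  using N1_subset N2_subset by (auto simp: core_group_def)

lemma card_group: "card (core_group w) \<in> {1, 2}"
proof -
  have "card {w' \<in> N1. g w' = w} \<le> 1"
    using g(1) finite_N1 by (auto simp: card_le_Suc0_iff_eq inj_on_def)
  moreover have "finite {w' \<in> N1. g w' = w}" using finite_N1 by simp
  ultimately have "card (core_group w) \<le> 2" "0 < card (core_group w)"
    unfolding core_group_def by (auto simp: card_insert_if card_gt_0_iff)
  then show ?thesis by auto
qed

lemma part_size: "part_size w \<in> {r - 1, r - 2}" "0 < part_size w" "part_size w dvd M"
proof -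
  show *: "part_size w \<in> {r - 1, r - 2}"
    using card_group[of w] by (auto simp: part_size_def)
  then show "0 < part_size w" using r by auto
  show "part_size w dvd M"
    using * M(1) by (auto intro: dvd_mult_left dvd_mult_right)
qed

text \<open>\<open>part_size w\<close> divides \<open>M\<close>, so no class straddles
  \<open>M\<close>.\<close>

lemma part_subset:
  assumes "x < M"
  shows "{y. y div part_size w = x div part_size w} \<subseteq> {..<M}"
proof
  fix y assume "y \<in> {y. y div part_size w = x div part_size w}"
  moreover have "x div part_size w < M div part_size w"
    using assms part_size by (simp add: less_mult_imp_div_less)
  ultimately show "y \<in> {..<M}"
    using div_le_mono[of M y "part_size w"] by (cases "y < M") auto
qed

text \<open>If \<open>w\<close> and \<open>w'\<close> differed, \<open>w\<close> would lie in
  \<open>N1\<close> with \<open>g w = w'\<close>, but \<open>g\<close> fixes \<open>w\<close> as a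
  common neighbour.\<close>

lemma group_inj:
  assumes "w \<in> N2" "w' \<in> N2" "core_group w = core_group w'"
  shows "w = w'"
proof -
  have "w \<in> core_group w'" "w' \<in> core_group w" using assms(3) by (auto simp: core_group_def)
  then show ?thesis using g(3)[of w] assms(1) by (auto simp: core_group_def)
qed

text \<open>Classes stay below \<open>M\<close> and the core lies at or above it, so the two parts
  of a link hyperedge can be read off by position.\<close>

lemma link_edge_low: "w \<in> N2 \<Longrightarrow> x < M \<Longrightarrow>
    link_edge w x \<inter> {..<M} = {y. y div part_size w = x div part_size w}"
  using part_subset[of x w] group_subset[of w] \<psi>(2) by (fastforce simp: link_edge_def)

lemma link_edge_high: "w \<in> N2 \<Longrightarrow> x < M \<Longrightarrow> link_edge w x - {..<M} = \<psi> ` core_group w"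
  using part_subset[of x w] group_subset[of w] \<psi>(2) by (fastforce simp: link_edge_def)

lemma link_edge_inj:
  assumes "w \<in> N2" "w' \<in> N2" "x < M" "x' < M" "link_edge w x = link_edge w' x'"
  shows "w = w'"
proof -
  have "\<psi> ` core_group w = \<psi> ` core_group w'"
    using link_edge_high assms by metis
  then have "core_group w = core_group w'"
    using \<psi>(1) group_subset assms(1,2) by (metis inj_on_image_eq_iff)
  then show ?thesis using group_inj assms by blast
qed

lemma rest_subset: "a \<in> ER \<Longrightarrow> a \<subseteq> R"
  using edge_subset by auto

lemma core_edge_range: "a \<in> ER \<Longrightarrow> core_edge a \<subseteq> {M..<n}"
  using rest_subset[of a] \<psi>(2) S(1)[of a] by (fastforce simp: core_edge_def)

text \<open>Since \<open>r\<close> is at least 3, padding sets are nonempty, and their vertices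
  avoid the core and all other padding sets.\<close>

lemma core_edge_inj: "inj_on core_edge ER"
proof (rule inj_onI, rule ccontr)
  fix a b assume *: "a \<in> ER" "b \<in> ER" "core_edge a = core_edge b" "a \<noteq> b"
  have "S a \<noteq> {}" using S(2)[of a] * r by auto
  then obtain z where z: "z \<in> S a" by auto
  then have "z \<notin> S b" using S(3)[of a b] * by auto
  moreover have "z \<notin> \<psi> ` b" using z S(1)[of a] * rest_subset[of b] by auto
  ultimately show False using * z by (auto simp: core_edge_def)
qed

lemma link_edge_neq_core_edge:
  assumes "w \<in> N2" "x < M" "a \<in> ER"
  shows "link_edge w x \<noteq> core_edge a"
proof -
  have "x \<in> link_edge w x" by (simp add: link_edge_def)
  moreover have "x \<notin> core_edge a" using core_edge_range[OF assms(3)] assms(2) by auto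
  ultimately show ?thesis by auto
qed

lemma uniform_base: "uniform_hypergraph r {..<n} base_edges"
proof -
  have "e \<subseteq> {..<n} \<and> card e = r" if "e \<in> base_edges" for e
    using that unfolding base_edges_def
  proof
    assume "e \<in> core_edge ` ER"
    then obtain a where a: "a \<in> ER" and e: "e = core_edge a" by blast
    have "card (\<psi> ` a) = 2"
      using card_edge[of a] rest_subset[OF a] a \<psi>(1)
      by (metis (lifting) card_image inj_on_subset mem_Collect_eq)
    moreover have "finite (S a)" using S(1)[of a] a finite_subset[of "S a" "{M..<n}"] by auto
    moreover have "finite (\<psi> ` a)" using rest_subset[OF a] finite_VF
      by (meson finite_Diff finite_imageI finite_subset)
    moreover have "\<psi> ` a \<inter> S a = {}" using S(1)[of a] a rest_subset[OF a] by auto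
    ultimately have "card e = r"
      using S(2)[of a] a r by (simp add: e core_edge_def card_Un_disjoint)
    then show ?thesis using core_edge_range[OF a] e by auto
  next
    assume "e \<in> (\<Union>w\<in>N2. link_edge w ` {..<M})"
    then obtain w x where w: "w \<in> N2" and x: "x < M" and e: "e = link_edge w x" by auto
    let ?Q = "{y. y div part_size w = x div part_size w}"
    have "card (\<psi> ` core_group w) = card (core_group w)"
      using group_subset[OF w] \<psi>(1) by (metis card_image inj_on_subset)
    moreover have "card ?Q = part_size w"
      using part_size(2)[of w] by (simp add: div_class_eq)
    moreover have "\<psi> ` core_group w \<inter> ?Q = {}"
      using link_edge_low[OF w x] link_edge_high[OF w x] by auto
    moreover have "finite ?Q" using finite_subset[OF part_subset[OF x]] by simp
    moreover have "finite (\<psi> ` core_group w)"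
      using finite_N1 by (simp add: core_group_def)
    ultimately have "card e = card (core_group w) + part_size w"
      by (simp add: e link_edge_def card_Un_disjoint)
    then have "card e = r" using card_group[of w] r by (auto simp: part_size_def)
    moreover have "e \<subseteq> {..<n}"
      using part_subset[OF x] group_subset[OF w] \<psi>(2) M(2) unfolding e link_edge_def
      by fastforce
    ultimately show ?thesis by simp
  qed
  then show ?thesis by (simp add: uniform_hypergraph_def hypergraph_def)
qed

section \<open>Berge-freeness of the base hypergraph\<close>

lemma finite_base: "finite base_edges"
  using finite_N2 finite_EF by (simp add: base_edges_def)

text \<open>Below \<open>M\<close> a vertex meets one link hyperedge for each element of
  \<open>N2\<close> and no core hyperedge. Any other vertex outside the core can only be padding, so
  it lies in at most one hyperedge.\<close>

lemma degree_base_outside_core: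
  assumes "degree EF u2 \<ge> 2" "z \<notin> \<psi> ` R"
  shows "degree base_edges z < degree EF u2"
proof (cases "z < M")
  case True
  have "{e \<in> base_edges. z \<in> e} \<subseteq> (\<lambda>w. link_edge w z) ` N2"
  proof
    fix e assume e: "e \<in> {e \<in> base_edges. z \<in> e}"
    then have "e \<notin> core_edge ` ER" using core_edge_range True by fastforce
    with e obtain w x where w: "w \<in> N2" and x: "x < M" and "e = link_edge w x"
      by (auto simp: base_edges_def)
    moreover from this have "z div part_size w = x div part_size w"
      using link_edge_low[OF w x] e True by auto
    ultimately show "e \<in> (\<lambda>w. link_edge w z) ` N2"
      by (auto simp: link_edge_def)
  qed
  then have "degree base_edges z \<le> card N2"
    unfolding degree_def using finite_N2 by (meson card_image_le card_mono finite_imageI le_trans)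
  then show ?thesis using card_N2 assms(1) by linarith
next
  case False
  have "e = e'" if e: "e \<in> base_edges" "z \<in> e" "e' \<in> base_edges" "z \<in> e'" for e e'
  proof -
    have *: "\<exists>a\<in>ER. e = core_edge a \<and> z \<in> S a" if "e \<in> base_edges" "z \<in> e" for e
    proof -
      have "z \<notin> link_edge w x" if w: "w \<in> N2" and x: "x < M" for w x
        using link_edge_high[OF w x] group_subset[OF w] False assms(2) by auto
      then have "e \<notin> (\<Union>w\<in>N2. link_edge w ` {..<M})"
        using that(2) by auto
      with that obtain a where "a \<in> ER" "e = core_edge a" by (auto simp: base_edges_def)
      moreover from this have "z \<in> S a"
        using that(2) assms(2) rest_subset by (auto simp: core_edge_def)
      ultimately show ?thesis by blast
    qed
    from *[OF e(1,2)] obtain a where "a \<in> ER" "e = core_edge a" "z \<in> S a" by blast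
    moreover from *[OF e(3,4)] obtain a' where "a' \<in> ER" "e' = core_edge a'" "z \<in> S a'" by blast
    ultimately show ?thesis using S(3)[of a a'] by auto
  qed
  then have "card {e \<in> base_edges. z \<in> e} \<le> Suc 0"
    using finite_base by (subst card_le_Suc0_iff_eq) auto
  then show ?thesis using assms(1) by (simp add: degree_def)
qed

lemma base_Berge_free: "\<not> contains_Berge VF EF {..<n} base_edges"
proof
  assume "contains_Berge VF EF {..<n} base_edges"
  then obtain \<phi> f where \<phi>: "inj_on \<phi> VF" and f: "inj_on f EF" "f ` EF \<subseteq> base_edges"
     "\<forall>a\<in>EF. \<phi> ` a \<subseteq> f a"
    using uniform_base by (auto simp: contains_Berge_iff uniform_hypergraph_def)
  show False
  proof (cases "degree EF u2 \<ge> 2")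
    case True
    \<comment> \<open>The core has two vertices fewer than \<open>VF\<close>, so the copy has at
      least two vertices outside it.\<close>
    have "card (\<psi> ` R) = card VF - 2"
      using \<psi>(1) u12 finite_VF by (simp add: card_image card_Diff_subset)
    moreover have "card (\<phi> ` VF) = card VF" using \<phi> by (rule card_image)
    moreover have "2 \<le> card VF"
      using card_mono[OF finite_VF, of "{u1, u2}"] u12 by simp
    moreover have "card (\<phi> ` VF) - card (\<psi> ` R) \<le> card (\<phi> ` VF - \<psi> ` R)"
      using finite_VF by (intro diff_card_le_card_Diff) auto
    ultimately have "2 \<le> card (\<phi> ` VF - \<psi> ` R)" by linarith
    then obtain T where "T \<subseteq> \<phi> ` VF - \<psi> ` R" "card T = 2"
      by (rule obtain_subset_with_card_n)
    then obtain z z' where "z \<noteq> z'" "z \<in> \<phi> ` VF - \<psi> ` R" "z' \<in> \<phi> ` VF - \<psi> ` R"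
      by (auto simp: card_2_iff)
    then obtain u w where uw: "u \<in> VF" "w \<in> VF" "u \<noteq> w" "\<phi> u \<notin> \<psi> ` R" "\<phi> w \<notin> \<psi> ` R"
      by auto
    have "degree EF u < degree EF u2" "degree EF w < degree EF u2"
      using degree_base_outside_core[OF True] degree_le_degree_of_Berge[OF finite_base f] uw
      by (meson le_less_trans)+
    with lower_degree uw show False by fastforce
  next
    case False \<comment> \<open>the degree argument fails for \<open>d\<^sub>2 = 1\<close>, where there are too few hyperedges\<close>
    then have "N2 = {}" using card_N2 finite_N2 by auto
    then have "base_edges = core_edge ` ER" unfolding base_edges_def
      by (simp only: UN_empty Un_empty_left)
    then have "card base_edges \<le> card ER" using card_image_le[of ER core_edge] finite_EF by simp
    \<comment> \<open>\<open>{u1, u2}\<close> contributes no core hyperedge, so the graph has more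
      edges than there are hyperedges.\<close>
    also have "card ER < card EF"
    proof (rule psubset_card_mono[OF finite_EF], rule psubsetI[OF Collect_subset])
      have "{u1, u2} \<notin> ER" by simp
      with edge show "ER \<noteq> EF" by metis
    qed
    also have "card EF \<le> card base_edges"
      using f(1,2) finite_base by (rule card_inj_on_le)
    finally show False by simp
  qed
qed

section \<open>A hyperedge meeting two blocks completes a Berge copy\<close>

lemma EF_cases [consumes 1, case_names edge N1 N2 rest]:
  assumes "a \<in> EF"
  obtains "a = {u1, u2}" | w where "w \<in> N1" "a = {u1, w}" | w where "w \<in> N2" "a = {u2, w}"
    | "a \<in> ER"
proof -
  obtain p q where pq: "a = {p, q}" using card_edge[OF assms] by (auto simp: card_2_iff)
  show thesis
  proof (cases "u1 \<in> a \<or> u2 \<in> a")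
    case False then show ?thesis using assms that(4) by blast
  next
    case True
    then obtain w where "a = {u1, w} \<or> a = {u2, w}" using pq by auto
    then show ?thesis using assms that(1-3) unfolding neighbours_def
      by (cases "w = u1 \<or> w = u2") (auto simp: insert_commute dest: card_edge)
  qed
qed

text \<open>\<open>x\<close> plays \<open>u1\<close>, \<open>y\<close> plays \<open>u2\<close> and
  \<open>e\<close> supplies the edge between them. The other edges at \<open>u1\<close> use link
  hyperedges through \<open>x\<close>, those at \<open>u2\<close> link hyperedges through
  \<open>y\<close>; no link hyperedge contains both.\<close>

lemma insert_creates_Berge:
  assumes e: "e \<subseteq> {..<n}" "e \<notin> base_edges" and xy: "x \<in> e" "y \<in> e" "x < M" "y < M"
    and blocks: "x div ((r - 1) * (r - 2)) \<noteq> y div ((r - 1) * (r - 2))"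
  shows "contains_Berge VF EF {..<n} (insert e base_edges)"
proof -
  have sep: "y \<notin> link_edge w x" if "w \<in> N2" for w
  proof
    assume "y \<in> link_edge w x"
    then have "y div part_size w = x div part_size w"
      using link_edge_low[OF that xy(3)] xy(4) by auto
    \<comment> \<open>Both possible part sizes divide the block size, so every class lies inside one
      block.\<close>
    moreover have "\<exists>k. (r - 1) * (r - 2) = part_size w * k"
      using part_size(1)[of w] by (auto simp: mult.commute)
    ultimately show False using blocks by (metis div_mult2_eq)
  qed
  define \<phi> where "\<phi> = (\<lambda>w. if w = u1 then x else if w = u2 then y else \<psi> w)"
  \<comment> \<open>\<open>the_elem\<close> picks the other endpoint. \<open>{u1, u2}\<close> is
    tested first because it also passes the test for \<open>u1\<close>.\<close>
  define f where "f = (\<lambda>a. if a = {u1, u2} then e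
      else if u1 \<in> a then link_edge (g (the_elem (a - {u1}))) x
      else if u2 \<in> a then link_edge (the_elem (a - {u2})) y
      else core_edge a)"
  have "x \<noteq> y" using blocks by auto
  have high: "M \<le> \<psi> w" "\<psi> w < n" if "w \<in> R" for w using \<psi>(2) that by fastforce+
  have "inj_on \<phi> VF"
  proof (rule inj_onI)
    fix a b assume "a \<in> VF" "b \<in> VF" "\<phi> a = \<phi> b"
    then show "a = b"
      using high[of a] high[of b] inj_onD[OF \<psi>(1), of a b] xy \<open>x \<noteq> y\<close> unfolding \<phi>_def
      by (auto split: if_splits)
  qed
  moreover have "\<phi> ` VF \<subseteq> {..<n}"
    using high xy M(2) by (auto simp: \<phi>_def)
  moreover
  have f_edge: "f {u1, u2} = e" by (simp add: f_def)
  have f_N1: "f {u1, w} = link_edge (g w) x" "g w \<in> N2" if "w \<in> N1" for w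
  proof -
    have "w \<noteq> u1" "w \<noteq> u2" using that N1_subset by auto
    then have "{u1, w} - {u1} = {w}" "{u1, w} \<noteq> {u1, u2}" by auto
    then show "f {u1, w} = link_edge (g w) x" by (simp add: f_def)
    show "g w \<in> N2" using g(2) that by blast
  qed
  have f_N2: "f {u2, w} = link_edge w y" if "w \<in> N2" for w
  proof -
    have "w \<noteq> u1" "w \<noteq> u2" using that N2_subset by auto
    then have "{u2, w} - {u2} = {w}" "{u2, w} \<noteq> {u1, u2}" "u1 \<notin> {u2, w}" using u12 by auto
    then show ?thesis by (simp add: f_def)
  qed
  have f_ER: "f a = core_edge a" if "a \<in> ER" for a
    using that by (auto simp: f_def)
  have base: "link_edge w x \<in> base_edges" "link_edge w y \<in> base_edges" if "w \<in> N2" for w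
    using that xy by (auto simp: base_edges_def)
  have base_core: "core_edge a \<in> base_edges" if "a \<in> ER" for a
    using that by (auto simp: base_edges_def)
  have "f ` EF \<subseteq> insert e base_edges"
  proof
    fix h assume "h \<in> f ` EF"
    then obtain a where "a \<in> EF" "h = f a" by blast
    then show "h \<in> insert e base_edges"
      by (cases a rule: EF_cases) (use f_edge f_N1 f_N2 f_ER base base_core in auto)
  qed
  moreover have "\<forall>a\<in>EF. \<phi> ` a \<subseteq> f a"
  proof
    fix a assume "a \<in> EF"
    then show "\<phi> ` a \<subseteq> f a"
    proof (cases a rule: EF_cases)
      case edge then show ?thesis using xy u12 by (auto simp: f_edge \<phi>_def)
    next
      case (N1 w)
      then have "\<phi> w = \<psi> w" using N1_subset by (auto simp: \<phi>_def)
      \<comment> \<open>Because of this membership, \<open>link_edge (g w) x\<close> contains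
        \<open>\<psi> w\<close> and so covers the image of \<open>{u1, w}\<close>.\<close>
      moreover have "w \<in> core_group (g w)" using N1 by (simp add: core_group_def)
      ultimately show ?thesis using N1 f_N1 by (auto simp: \<phi>_def link_edge_def)
    next
      case (N2 w)
      then have "\<phi> w = \<psi> w" using N2_subset by (auto simp: \<phi>_def)
      moreover have "w \<in> core_group w" by (simp add: core_group_def)
      ultimately show ?thesis using N2 f_N2 u12 by (auto simp: \<phi>_def link_edge_def)
    next
      case rest
      then have "\<phi> ` a = \<psi> ` a" by (auto simp: \<phi>_def intro!: image_cong)
      then show ?thesis using f_ER[OF rest] by (simp add: core_edge_def)
    qed
  qed
  moreover have "inj_on f EF"
  proof -
    \<comment> \<open>Every \<open>link_edge w' y\<close> contains \<open>y\<close>, whereas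
      \<open>sep\<close> keeps \<open>y\<close> out of \<open>link_edge w x\<close>, even for
      \<open>w' = w\<close>.\<close>
    have xy_neq: "link_edge w x \<noteq> link_edge w' y" if "w \<in> N2" for w w'
      using sep[OF that] by (auto simp: link_edge_def)
    have "a = b" if a: "a \<in> EF" and b: "b \<in> EF" and eq: "f a = f b" for a b
      using a
    proof (cases a rule: EF_cases)
      case edge
      \<comment> \<open>\<open>e\<close> is new, whereas all other values of \<open>f\<close> are
        base hyperedges.\<close>
      from b show ?thesis
        by (cases b rule: EF_cases)
          (use edge eq e(2) f_edge f_N1 f_N2 f_ER base base_core in auto)
    next
      case (N1 w)
      from b show ?thesis
      proof (cases b rule: EF_cases)
        case edge then show ?thesis using N1 eq e(2) f_edge f_N1 base by auto
      next
        case (N1 w')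
        then have "g w = g w'"
          using link_edge_inj[of "g w" "g w'" x x] f_N1 \<open>w \<in> N1\<close> \<open>a = {u1, w}\<close> eq xy by metis
        then show ?thesis using g(1) N1 \<open>w \<in> N1\<close> \<open>a = {u1, w}\<close> by (auto simp: inj_on_def)
      next
        case (N2 w')
        then show ?thesis
          using xy_neq[OF f_N1(2)[OF N1(1)], of w'] f_N1(1)[OF N1(1)] f_N2[OF N2(1)] eq N1(2) by simp
      next
        case rest
        then show ?thesis
          using link_edge_neq_core_edge[OF f_N1(2)[OF N1(1)] xy(3) rest]
            f_N1(1)[OF N1(1)] f_ER[OF rest] eq N1(2) by simp
      qed
    next
      case (N2 w)
      from b show ?thesis
      proof (cases b rule: EF_cases)
        case edge then show ?thesis using N2 eq e(2) f_edge f_N2 base by auto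
      next
        case (N1 w')
        then show ?thesis
          using xy_neq[OF f_N1(2)[OF N1(1)], of w] f_N1(1)[OF N1(1)] f_N2[OF N2(1)] eq N2(2) by simp
      next
        case (N2 w')
        then show ?thesis
          using link_edge_inj[of w w' y y] f_N2 \<open>w \<in> N2\<close> \<open>a = {u2, w}\<close> eq xy by metis
      next
        case rest
        then show ?thesis
          using link_edge_neq_core_edge[OF N2(1) xy(4) rest] f_N2[OF N2(1)] f_ER[OF rest] eq N2(2)
          by simp
      qed
    next
      case rest
      from b show ?thesis
      proof (cases b rule: EF_cases)
        case edge then show ?thesis using rest eq e(2) f_edge f_ER base_core by auto
      next
        case (N1 w')
        then show ?thesis
          using link_edge_neq_core_edge[OF f_N1(2)[OF N1(1)] xy(3) rest]
            f_N1(1)[OF N1(1)] f_ER[OF rest] eq N1(2) by simp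
      next
        case (N2 w')
        then show ?thesis
          using link_edge_neq_core_edge[OF N2(1) xy(4) rest] f_N2[OF N2(1)] f_ER[OF rest] eq N2(2)
          by simp
      next
        case rest': rest
        show ?thesis using core_edge_inj rest rest' eq f_ER by (auto simp: inj_on_def)
      qed
    qed
    then show ?thesis unfolding inj_on_def by blast
  qed
  moreover have "hypergraph {..<n} (insert e base_edges)"
    using e(1) uniform_base by (simp add: uniform_hypergraph_def hypergraph_def)
  ultimately show ?thesis by (subst contains_Berge_iff) blast+
qed

section \<open>Linear bound on saturated extensions\<close>

text \<open>The part of a base hyperedge below \<open>M\<close> is a single class, hence inside a
  block. Any other hyperedge of \<open>E\<close> meeting two blocks would complete a Berge copy
  within \<open>E\<close>.\<close>

lemma same_block:
  assumes "Berge_saturated r VF EF {..<n} E" "base_edges \<subseteq> E" "e \<in> E"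
    and xy: "x \<in> e" "y \<in> e" "x < M" "y < M"
  shows "x div ((r - 1) * (r - 2)) = y div ((r - 1) * (r - 2))"
proof (cases "e \<in> base_edges")
  case True
  moreover have "e \<notin> core_edge ` ER" using core_edge_range xy by fastforce
  ultimately obtain w z where w: "w \<in> N2" and z: "z < M" and "e = link_edge w z"
    by (auto simp: base_edges_def)
  with xy have "x \<in> link_edge w z \<inter> {..<M}" "y \<in> link_edge w z \<inter> {..<M}"
    by simp_all
  then have "x div part_size w = y div part_size w"
    unfolding link_edge_low[OF w z] by simp
  moreover have "\<exists>k. (r - 1) * (r - 2) = part_size w * k"
    using part_size(1)[of w] by (auto simp: mult.commute)
  ultimately show ?thesis by (metis div_mult2_eq)
next
  case False
  have "e \<subseteq> {..<n}" and sub: "insert e base_edges \<subseteq> E" and free: "\<not> contains_Berge VF EF {..<n} E"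
    using assms(1-3) by (auto simp: Berge_saturated_def uniform_hypergraph_def hypergraph_def)
  from insert_creates_Berge[OF this(1) False xy] contains_Berge_mono[OF _ sub] free
  show ?thesis by metis
qed

text \<open>Every hyperedge lies in one block together with the vertices from \<open>M\<close> on.
  Counting all subsets of these sets, one for each block index up to \<open>n\<close>, is linear in
  \<open>n\<close> once \<open>n - M\<close> is bounded.\<close>

lemma card_saturated_le:
  assumes "Berge_saturated r VF EF {..<n} E" "base_edges \<subseteq> E"
  shows "card E \<le> Suc n * 2 ^ (n - M + (r - 1) * (r - 2))"
proof -
  define m where "m = (r - 1) * (r - 2)"
  have m: "0 < m" using r by (simp add: m_def)
  define B where "B = (\<lambda>j. {M..<n} \<union> {y. y div m = j})"
  have fin: "finite (B j)" for j using m by (simp add: B_def div_class_eq)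
  have "card (B j) \<le> n - M + m" for j
    unfolding B_def using m by (intro card_Un_le[THEN le_trans]) (simp add: div_class_eq)
  then have bound: "card (Pow (B j)) \<le> 2 ^ (n - M + m)" for j
    using fin by (simp add: card_Pow)
  have "E \<subseteq> (\<Union>j\<in>{..n}. Pow (B j))"
  proof
    fix e assume e: "e \<in> E"
    have range: "e \<subseteq> {..<n}"
      using assms(1) e by (auto simp: Berge_saturated_def uniform_hypergraph_def hypergraph_def)
    show "e \<in> (\<Union>j\<in>{..n}. Pow (B j))"
    proof (cases "\<exists>x\<in>e. x < M")
      case True
      then obtain x where x: "x \<in> e" "x < M" by blast
      have "e \<subseteq> B (x div m)"
      proof
        fix y assume "y \<in> e"
        then show "y \<in> B (x div m)"
          using same_block[OF assms e _ x(1) _ x(2), of y] range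
            by (cases "y < M") (auto simp: B_def m_def)
      qed
      moreover have "x div m \<le> n"
        using x(2) M(2) div_le_dividend[of x m] by linarith
      ultimately show ?thesis by blast
    next
      case False
      \<comment> \<open>Without vertices below \<open>M\<close> the hyperedge fits any block; index
        0 is an arbitrary choice.\<close>
      then have "e \<subseteq> B 0"
        using range unfolding B_def
        by (meson UnI1 atLeastLessThan_iff lessThan_iff not_le subset_iff)
      then show ?thesis by blast
    qed
  qed
  then have "card E \<le> card (\<Union>j\<in>{..n}. Pow (B j))"
    using fin by (intro card_mono) auto
  also have "\<dots> \<le> (\<Sum>j\<in>{..n}. card (Pow (B j)))"
    by (rule card_UN_le) simp
  also have "\<dots> \<le> (\<Sum>j\<in>{..n}. 2 ^ (n - M + m))"
    using bound by (intro sum_mono) simp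
  finally show ?thesis by (simp add: m_def)
qed

lemma sat_le: "sat r n VF EF \<le> Suc n * 2 ^ (n - M + (r - 1) * (r - 2))"
proof -
  obtain E where E: "base_edges \<subseteq> E" "Berge_saturated r VF EF {..<n} E"
    using Berge_saturated_extension[OF uniform_base base_Berge_free] by blast
  have "finite {..<n}" "card {..<n} = n" by simp_all
  with E(2) have "sat r n VF EF \<le> card E"
    unfolding sat_def by (intro cInf_lower) blast+
  also note card_saturated_le[OF E(2,1)]
  finally show ?thesis .
qed

end

section \<open>Choice of the parameters for large \<open>n\<close>\<close>

theorem theorem1p3:
  fixes VF :: "'a set" and EF :: "'a set set" and r :: nat
  assumes "simple_graph VF EF"
    and "type_I VF EF"
    and "r \<ge> 3"
  shows "(\<lambda>n. real (sat r n VF EF)) \<in> O(\<lambda>n. real n)"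
proof -
  from assms(2) obtain u1 u2 where u: "u1 \<in> VF" "u2 \<in> VF" "{u1, u2} \<in> EF"
    and d: "degree EF u1 = degree_sequence VF EF ! 0" "degree EF u2 = degree_sequence VF EF ! 1"
    unfolding type_I_def by blast
  have finVF: "finite VF" and EF: "\<And>a. a \<in> EF \<Longrightarrow> a \<subseteq> VF \<and> card a = 2"
    using assms(1) by (auto simp: uniform_hypergraph_def hypergraph_def)
  then have finEF: "finite EF" by (meson Pow_iff finite_Pow_iff finite_subset subsetI)
  have neq: "u1 \<noteq> u2" using EF[OF u(3)] by auto
  let ?N1 = "neighbours EF u1 - {u2}" and ?N2 = "neighbours EF u2 - {u1}"
  have fin: "finite (neighbours EF v)" for v
  proof (rule finite_subset[OF _ finVF], rule subsetI)
    fix w assume "w \<in> neighbours EF v"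
    then have "{v, w} \<subseteq> VF" using EF[of "{v, w}"] by (simp add: neighbours_def)
    then show "w \<in> VF" by simp
  qed
  have "card ?N1 = degree EF u1 - 1" "card ?N2 = degree EF u2 - 1"
    using card_neighbours_remove[OF assms(1)] u(3) by (simp_all add: insert_commute)
  \<comment> \<open>The first degree is at most the second, so the remaining neighbours of
    \<open>u1\<close> can be injected into those of \<open>u2\<close>.\<close>
  then have "card ?N1 \<le> card ?N2"
    using degree_sequence_second(1)[OF finVF u(1,2) neq, of EF] d by simp
  then obtain g where g: "inj_on g ?N1" "g ` ?N1 \<subseteq> ?N2" "\<And>w. w \<in> ?N1 \<Longrightarrow> w \<in> ?N2 \<Longrightarrow> g w = w"
    using extend_identity_inj[of ?N1 ?N2] fin by blast
  define m where "m = (r - 1) * (r - 2)"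
  have m: "0 < m" using assms(3) by (simp add: m_def)
  \<comment> \<open>Labels for the reserved vertices: one per core vertex and \<open>r - 2\<close>
    padding vertices per edge. Their number does not depend on \<open>n\<close>.\<close>
  define X where "X = (VF - {u1, u2}) <+> (EF \<times> {..<r - 2})"
  have finX: "finite X" using finVF finEF by (simp add: X_def)
  \<comment> \<open>One \<open>m\<close> bounds the vertices from \<open>M\<close> on beyond
    \<open>card X\<close>; the other is the block size in \<open>card_saturated_le\<close>.\<close>
  define C where "C = (2 :: nat) ^ (card X + 2 * m)"
  have bound: "sat r n VF EF \<le> Suc n * C" if n: "card X \<le> n" for n
  proof -
    \<comment> \<open>The largest multiple of \<open>m\<close> that leaves at least
      \<open>card X\<close> vertices from \<open>M\<close> on.\<close>
    define M where "M = m * ((n - card X) div m)"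
    have M_bounds: "M \<le> n - card X" "n - card X < M + m"
      using dividend_less_times_div[OF m, of "n - card X"] by (simp_all add: M_def add.commute)
    have "card X \<le> card {M..<n}" using M_bounds n by simp
    then obtain h where h: "h ` X \<subseteq> {M..<n}" "inj_on h X"
      using card_le_inj[OF finX, of "{M..<n}"] by auto
    define \<psi> where "\<psi> = (\<lambda>w. h (Inl w))"
    define S where "S = (\<lambda>a. (\<lambda>i. h (Inr (a, i))) ` {..<r - 2})"
    have h_eq: "h p = h q \<longleftrightarrow> p = q" if "p \<in> X" "q \<in> X" for p q
      using inj_on_eq_iff[OF h(2) that] .
    have in_X: "Inl w \<in> X \<longleftrightarrow> w \<in> VF - {u1, u2}" "Inr (a, i) \<in> X \<longleftrightarrow> a \<in> EF \<and> i < r - 2" for w a i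
      by (auto simp: X_def)
    interpret type_I_construction VF EF u1 u2 g r n M \<psi> S
    proof
      show "degree EF u2 \<le> degree EF u \<or> degree EF u2 \<le> degree EF w"
        if "u \<in> VF" "w \<in> VF" "u \<noteq> w" for u w
        using degree_sequence_second(2)[OF finVF that] d by simp
      show "inj_on \<psi> (VF - {u1, u2})"
        by (rule inj_onI) (simp add: \<psi>_def h_eq in_X)
      show "\<psi> ` (VF - {u1, u2}) \<subseteq> {M..<n}"
        using h(1) in_X(1) unfolding \<psi>_def by blast
      show "S a \<subseteq> {M..<n} - \<psi> ` (VF - {u1, u2})" if "a \<in> EF" for a
      proof
        fix z assume "z \<in> S a"
        then obtain i where i: "i < r - 2" "z = h (Inr (a, i))" by (auto simp: S_def)
        then have "z \<in> {M..<n}" using h(1) in_X(2)[of a i] that by blast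
        moreover have "z \<noteq> \<psi> w" if "w \<in> VF - {u1, u2}" for w
          using h_eq[of "Inr (a, i)" "Inl w"] in_X i \<open>a \<in> EF\<close> that by (simp add: \<psi>_def)
        ultimately show "z \<in> {M..<n} - \<psi> ` (VF - {u1, u2})" by blast
      qed
      show "card (S a) = r - 2" if "a \<in> EF" for a
      proof -
        have "inj_on (\<lambda>i. h (Inr (a, i))) {..<r - 2}"
          by (rule inj_onI) (simp add: h_eq in_X that)
        then show ?thesis by (simp add: S_def card_image)
      qed
      show "S a \<inter> S b = {}" if "a \<in> EF" "b \<in> EF" "a \<noteq> b" for a b
        using that by (auto simp: S_def h_eq in_X)
      show "(r - 1) * (r - 2) dvd M" by (simp add: M_def m_def)
      show "M \<le> n" using M_bounds(1) by simp
    qed (use assms u g in auto)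
    have "n - M + m \<le> card X + 2 * m" using M_bounds n by linarith
    then have "Suc n * 2 ^ (n - M + m) \<le> Suc n * C"
      unfolding C_def by (intro mult_le_mono2 power_increasing) auto
    then show ?thesis using sat_le unfolding m_def by (rule le_trans[rotated])
  qed
  show ?thesis
  proof (rule bigoI[where c = "2 * real C"])
    show "\<forall>\<^sub>F n in sequentially. norm (real (sat r n VF EF)) \<le> 2 * real C * norm (real n)"
      unfolding eventually_sequentially
    proof (intro exI allI impI)
      \<comment> \<open>The successor ensures that \<open>n\<close> is positive, so that
        \<open>Suc n\<close> is at most \<open>2 * n\<close>.\<close>
      fix n assume n: "Suc (card X) \<le> n"
      then have "sat r n VF EF \<le> Suc n * C" by (intro bound) simp
      also have "\<dots> \<le> (2 * n) * C" using n by (intro mult_le_mono1) simp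
      finally have "real (sat r n VF EF) \<le> real (2 * n * C)" by (simp only: of_nat_le_iff)
      then show "norm (real (sat r n VF EF)) \<le> 2 * real C * norm (real n)"
        by (simp add: mult_ac)
    qed
  qed
qed

end
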